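(* Let $\mathbf{q}=(q_0,\dots,q_5)\in\mathbb{R}^6$ be such that the matrix $\begin{pmatrix} q_3 & \tfrac12 q_4\\ \tfrac12 q_4 & q_5\end{pmatrix}$ has positive eigenvalues and such that $\mathbb{X}=\{\mathbf{x}\in\mathbb{R}^2 : f(\mathbf{x})\le 0\}$ is a (non-degenerate) ellipse, where $f(\mathbf{x})=q_0+q_1x_1+q_2x_2+q_3x_1^2+q_4x_1x_2+q_5x_2^2$. Let $\sigma(\mathbf{q})=(q_0,q_2,q_1,q_5,q_4,q_3)$. The minimal contractor associated to the positive arc of the ellipse is the map on boxes $$C_0^{\mathbf{q}}([\mathbf{x}])=[\mathbf{x}]\cap\Big([\varphi_{\mathbf{q}}(b_2^+),\varphi_{\mathbf{q}}(b_2^-)]\times[\varphi_{\sigma(\mathbf{q})}(b_1^+),\varphi_{\sigma(\mathbf{q})}(b_1^-)]\Big),$$ where $[\mathbf{b}]=[b_1^-,b_1^+]\times[b_2^-,b_2^+]=[\mathbf{x}]\cap[\mathbf{a}]$ and $$[\mathbf{a}]=[\varphi_{\mathbf{q}}(\psi(\mathbf{q})),\,\psi(\sigma(\mathbf{q}))]\times[\varphi_{\sigma(\mathbf{q})}(\psi(\sigma(\mathbf{q}))),\,\psi(\mathbf{q})]$$ (with $C_0^{\mathbf{q}}([\mathbf{x}])=\emptyset$ if $[\mathbf{b}]=\emptyset$). That is, for every box $[\mathbf{x}]$, $C_0^{\mathbf{q}}([\mathbf{x}])$ is the smallest box containing the intersection of $[\mathbf{x}]$ with the positive arc.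
   Context: A box is a (possibly empty) Cartesian product of two compact intervals of $\mathbb{R}$. The minimal contractor associated to a set $S\subset\mathbb{R}^2$ is the map sending each box $[\mathbf{x}]$ to the smallest box containing $[\mathbf{x}]\cap S$ (the empty box if $[\mathbf{x}]\cap S=\emptyset$). For a parameter vector $\mathbf{p}=(p_0,\dots,p_5)$ and a real $t$, define $$\varphi_{\mathbf{p}}(t)=\frac{-(p_1+p_4t)+\sqrt{(p_1+p_4t)^2-4p_3(p_0+p_2t+p_5t^2)}}{2p_3}$$ and $$\psi(\mathbf{p})=\frac{-4p_3p_2+2p_1p_4+\sqrt{(4p_3p_2-2p_1p_4)^2-4(4p_3p_5-p_4^2)(4p_3p_0-p_1^2)}}{8p_3p_5-2p_4^2}.$$ The North of the ellipse is its top point (the point of $\{f=0\}$ with largest $x_2$), and the East is its rightmost point (the point of $\{f=0\}$ with largest $x_1$). The positive arc is the part of the boundary $\{f=0\}$ between the North and the East (the closed arc running from the top point clockwise to the rightmost point). *)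

theory Defs
  imports "HOL-Analysis.Analysis" "Jordan_Normal_Form.Char_Poly"
begin

section \<open>Boxes and minimal contractors\<close>

text \<open>Intervals \<^term>\<open>{a..b}\<close> with \<^prop>\<open>b < a\<close> are empty, so the empty set is a box.\<close>

definition is_box :: "(real \<times> real) set \<Rightarrow> bool" where
  "is_box B \<longleftrightarrow> (\<exists>a b c d. B = {a..b} \<times> {c..d})"

definition is_smallest_box :: "(real \<times> real) set \<Rightarrow> (real \<times> real) set \<Rightarrow> bool" where
  "is_smallest_box S B \<longleftrightarrow>
     is_box B \<and> S \<subseteq> B \<and> (\<forall>B'. is_box B' \<and> S \<subseteq> B' \<longrightarrow> B \<subseteq> B')"

definition is_minimal_contractor ::
    "(real \<times> real) set \<Rightarrow> ((real \<times> real) set \<Rightarrow> (real \<times> real) set) \<Rightarrow> bool" where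
  "is_minimal_contractor S C \<longleftrightarrow> (\<forall>X. is_box X \<longrightarrow> is_smallest_box (X \<inter> S) (C X))"


section \<open>The quadratic function and its ellipse\<close>

type_synonym params = "real \<times> real \<times> real \<times> real \<times> real \<times> real"

fun quad :: "params \<Rightarrow> real \<times> real \<Rightarrow> real" where
  "quad (q0, q1, q2, q3, q4, q5) (x1, x2) =
     q0 + q1 * x1 + q2 * x2 + q3 * x1\<^sup>2 + q4 * x1 * x2 + q5 * x2\<^sup>2"

fun quad_mat :: "params \<Rightarrow> real mat" where
  "quad_mat (q0, q1, q2, q3, q4, q5) = mat_of_rows_list 2 [[q3, q4 / 2], [q4 / 2, q5]]"

text \<open>Solid non-degenerate ellipses: images of the closed unit disc (for the Euclidean norm)
  under an invertible affine map.\<close>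

definition is_ellipse :: "(real \<times> real) set \<Rightarrow> bool" where
  "is_ellipse X \<longleftrightarrow>
     (\<exists>A c. linear A \<and> bij A \<and> X = (\<lambda>u. c + A u) ` cball (0 :: real \<times> real) 1)"


section \<open>The positive arc\<close>

definition north :: "params \<Rightarrow> real \<times> real" where
  "north q = (THE x. is_arg_max snd (\<lambda>y. quad q y = 0) x)"

definition east :: "params \<Rightarrow> real \<times> real" where
  "east q = (THE x. is_arg_max fst (\<lambda>y. quad q y = 0) x)"

definition centre :: "params \<Rightarrow> real \<times> real" where
  "centre q = (THE c. \<forall>v. quad q (c + v) = quad q (c - v))"

text \<open>The angle in \<open>[0, 2\<pi>)\<close> by which the direction of \<open>u\<close> has to be turned \<^emph>\<open>clockwise\<close> to
  reach the direction of \<open>v\<close>; for instance \<open>(0, 1)\<close> and \<open>(1, 0)\<close> give \<open>\<pi> / 2\<close>.\<close>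

definition cw_angle :: "real \<times> real \<Rightarrow> real \<times> real \<Rightarrow> real" where
  "cw_angle u v = Arg2pi (Complex (fst u) (snd u) / Complex (fst v) (snd v))"

text \<open>The points of the boundary met when running clockwise around the centre, starting at the
  North and stopping at the East. The condition \<^prop>\<open>quad q x = 0\<close> together with the bounding box
  of North and East would not do: for an ellipse elongated along the antidiagonal, that box also
  meets the opposite side of the boundary.\<close>

definition positive_arc :: "params \<Rightarrow> (real \<times> real) set" where
  "positive_arc q =
     {x. quad q x = 0 \<and>
         cw_angle (north q - centre q) (x - centre q)
           \<le> cw_angle (north q - centre q) (east q - centre q)}"


section \<open>The contractor\<close>

fun \<sigma> :: "params \<Rightarrow> params" where
  "\<sigma> (q0, q1, q2, q3, q4, q5) = (q0, q2, q1, q5, q4, q3)"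

fun \<phi> :: "params \<Rightarrow> real \<Rightarrow> real" where
  "\<phi> (p0, p1, p2, p3, p4, p5) t =
     (- (p1 + p4 * t) + sqrt ((p1 + p4 * t)\<^sup>2 - 4 * p3 * (p0 + p2 * t + p5 * t\<^sup>2))) / (2 * p3)"

fun \<psi> :: "params \<Rightarrow> real" where
  "\<psi> (p0, p1, p2, p3, p4, p5) =
     (- 4 * p3 * p2 + 2 * p1 * p4
        + sqrt ((4 * p3 * p2 - 2 * p1 * p4)\<^sup>2
                - 4 * (4 * p3 * p5 - p4\<^sup>2) * (4 * p3 * p0 - p1\<^sup>2)))
     / (8 * p3 * p5 - 2 * p4\<^sup>2)"

definition arc_box :: "params \<Rightarrow> (real \<times> real) set" where
  "arc_box q = {\<phi> q (\<psi> q) .. \<psi> (\<sigma> q)} \<times> {\<phi> (\<sigma> q) (\<psi> (\<sigma> q)) .. \<psi> q}"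

text \<open>The endpoints of the two sides of the non-empty box \<open>b = X \<inter> arc_box q\<close> are recovered as the
  infima and suprema of its projections.\<close>

definition C0 :: "params \<Rightarrow> (real \<times> real) set \<Rightarrow> (real \<times> real) set" where
  "C0 q X =
     (let b = X \<inter> arc_box q;
          b1_lo = Inf (fst ` b); b1_hi = Sup (fst ` b);
          b2_lo = Inf (snd ` b); b2_hi = Sup (snd ` b)
      in if b = {} then {}
         else X \<inter> ({\<phi> q b2_hi .. \<phi> q b2_lo} \<times> {\<phi> (\<sigma> q) b1_hi .. \<phi> (\<sigma> q) b1_lo}))"

end

theory Submission
  imports Defs
begin

text \<open>
  Being turned clockwise from the North and counterclockwise from the East, as seen from the
  centre, amounts to the signs of two cross products, and these are positive multiples of the two
  partial derivatives of the quadratic function \<open>f\<close>. So the positive arc consists of the zeros of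
  \<open>f\<close> at which both partial derivatives are nonnegative. By strict convexity, the gradient at a zero
  \<open>x\<close> has negative inner product with \<open>y - x\<close> for any other zero \<open>y\<close>; hence no two points of the arc
  are comparable in the product order, and the arc is the graph of a decreasing bijection between
  the sides of \<open>arc_box\<close>, given by \<open>\<phi>\<close> in both directions. The projections of \<open>X \<inter> arc\<close> can
  then be read off at the endpoints of the sides of \<open>X \<inter> arc_box\<close>.
\<close>

section \<open>Eigenvalues and definiteness of symmetric 2x2 matrices\<close>

text \<open>The hypothesis is the characteristic equation. The vector \<open>(b, k - a)\<close> is
  an eigenvector unless it vanishes, and then \<open>(1, 0)\<close> is one.\<close>

lemma eigenvalue_2x2:
  fixes a b c k :: real
  assumes k: "(a - k) * (c - k) = b\<^sup>2"
  shows "eigenvalue (mat_of_rows_list 2 [[a, b], [b, c]]) k"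
proof -
  define M where "M = mat_of_rows_list 2 [[a, b], [b, c]]"
  have M: "dim_row M = 2" "dim_col M = 2"
    "M $$ (0, 0) = a" "M $$ (0, Suc 0) = b" "M $$ (Suc 0, 0) = b" "M $$ (Suc 0, Suc 0) = c"
    by (simp_all add: M_def mat_of_rows_list_def)
  have ev: "eigenvalue M k"
    if xy: "x \<noteq> 0 \<or> y \<noteq> 0" "a * x + b * y = k * x" "b * x + c * y = k * y" for x y
  proof -
    define v where "v = vec 2 (\<lambda>i. if i = 0 then x else y)"
    have v: "dim_vec v = 2" "v $ 0 = x" "v $ Suc 0 = y" by (simp_all add: v_def)
    have 2: "{0..<2} = {0, Suc 0}" by auto
    have "(M *\<^sub>v v) $ i = (k \<cdot>\<^sub>v v) $ i" if "i < 2" for i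
      using less_2_cases[OF that] xy(2,3)
      by (elim disjE) (simp_all add: M v scalar_prod_def 2)
    hence "M *\<^sub>v v = k \<cdot>\<^sub>v v"
      by (intro eq_vecI) (simp_all add: M v)
    moreover have "v \<noteq> 0\<^sub>v 2"
    proof
      assume "v = 0\<^sub>v 2"
      hence "v $ 0 = 0" "v $ Suc 0 = 0" by simp_all
      thus False using xy(1) v by simp
    qed
    moreover have "v \<in> carrier_vec 2" unfolding v_def by (rule vec_carrier)
    ultimately have "eigenvector M v k" unfolding eigenvector_def M(1) by blast
    thus ?thesis unfolding eigenvalue_def by blast
  qed
  have "eigenvalue M k"
  proof (cases "b = 0 \<and> k = a")
    case True
    show ?thesis by (rule ev[of 1 0]) (simp_all add: True)
  next
    case False
    show ?thesis
    proof (rule ev[of b "k - a"])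
      show "b \<noteq> 0 \<or> k - a \<noteq> 0" using False by auto
      show "a * b + b * (k - a) = k * b" by (simp add: algebra_simps)
      have "(k - a) * (k - c) = b * b" using k by (simp add: algebra_simps power2_eq_square)
      thus "b * b + c * (k - a) = k * (k - a)" by (simp add: algebra_simps)
    qed
  qed
  thus ?thesis unfolding M_def .
qed

lemma pos_def_of_eigenvalues:
  fixes a b c :: real
  assumes pos: "\<And>k. eigenvalue (mat_of_rows_list 2 [[a, b], [b, c]]) k \<Longrightarrow> k > 0"
  shows "a > 0" "c > 0" "b\<^sup>2 < a * c"
proof -
  \<comment> \<open>\<open>k\<close> is the smaller eigenvalue.\<close>
  define s where "s = sqrt ((a - c)\<^sup>2 + 4 * b\<^sup>2)"
  define k where "k = (a + c - s) / 2"
  have s2: "s * s = (a - c)\<^sup>2 + 4 * b\<^sup>2" unfolding s_def by simp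
  have "(a - k) * (c - k) = b\<^sup>2"
    using s2 unfolding k_def by (simp add: field_simps power2_eq_square)
  hence k: "k > 0" using pos eigenvalue_2x2 by blast
  \<comment> \<open>Positivity of \<open>k\<close> means \<open>s < a + c\<close>, so |a - c| < a +
    c and both diagonal entries are positive; squaring \<open>s < a + c\<close> gives the
    determinant.\<close>
  have "s \<ge> \<bar>a - c\<bar>" unfolding s_def by (rule real_le_rsqrt) auto
  thus "a > 0" "c > 0" using k unfolding k_def by auto
  have "s < a + c" "s \<ge> 0" using k unfolding k_def s_def by auto
  hence "s * s < (a + c) * (a + c)" by (intro mult_strict_mono') auto
  moreover have "(a + c) * (a + c) = (a - c)\<^sup>2 + 4 * (a * c)"
    by (simp add: algebra_simps power2_eq_square)
  ultimately show "b\<^sup>2 < a * c" using s2 by linarith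
qed

section \<open>Clockwise angles and half-planes\<close>

text \<open>A sector of opening less than a half-turn is an intersection of two half-planes. In
  terms of the two angles \<open>a\<close> and \<open>b\<close>, the signs on the right are those of
  \<open>sin a\<close> and \<open>sin (b - a)\<close>.\<close>

lemma Arg2pi_divide_le_iff:
  fixes u v w :: complex
  assumes v: "v \<noteq> 0" and uw: "Im (u / w) > 0"
  shows "Arg2pi (u / v) \<le> Arg2pi (u / w) \<longleftrightarrow> Im (u / v) \<ge> 0 \<and> Im (v / w) \<ge> 0"
proof -
  have [simp]: "u \<noteq> 0" "w \<noteq> 0" using uw by auto
  define a where "a = Arg2pi (u / v)"
  define b where "b = Arg2pi (u / w)"
  have a: "0 \<le> a" "a < 2 * pi" unfolding a_def by (simp_all add: Arg2pi_ge_0 Arg2pi_lt_2pi)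
  have b: "0 < b" "b < pi" using uw Arg2pi_lt_pi[of "u / w"] unfolding b_def by simp_all
  define r where "r = cmod (u / v)"
  define s where "s = cmod (u / w)"
  have rs: "r > 0" "s > 0" unfolding r_def s_def using v by simp_all
  have uv: "u / v = of_real r * exp (\<i> * of_real a)"
    unfolding a_def r_def by (rule Arg2pi_eq)
  have uw': "u / w = of_real s * exp (\<i> * of_real b)"
    unfolding b_def s_def by (rule Arg2pi_eq)
  have "v / w = (u / w) / (u / v)" using v by simp
  also have "\<dots> = of_real (s / r) * exp (\<i> * of_real (b - a))"
    unfolding uv uw' by (simp add: exp_diff right_diff_distrib)
  finally have "Im (v / w) = s / r * sin (b - a)"
    by (simp add: Im_exp)
  moreover have "s / r > 0" using rs by simp
  ultimately have 1: "Im (v / w) \<ge> 0 \<longleftrightarrow> sin (b - a) \<ge> 0"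
    by (simp only: zero_le_mult_iff) auto
  have "Im (u / v) = r * sin a"
    unfolding uv by (simp add: Im_exp)
  hence 2: "Im (u / v) \<ge> 0 \<longleftrightarrow> sin a \<ge> 0"
    using rs by (simp only: zero_le_mult_iff) auto
  have 3: "a \<le> pi" if "sin a \<ge> 0"
    using that a sin_lt_zero[of a] by linarith
  \<comment> \<open>The bound \<open>a \<le> pi\<close> excludes the angles from
    \<open>b + pi\<close> on, where \<open>sin (b - a)\<close> is nonnegative again.\<close>
  have 4: "a \<le> b" if "sin (b - a) \<ge> 0" "a \<le> pi"
  proof (rule ccontr)
    assume "\<not> a \<le> b"
    hence "sin (a - b) > 0" using that b by (intro sin_gt_zero) auto
    moreover have "sin (a - b) = - sin (b - a)" using sin_minus[of "b - a"] by simp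
    ultimately show False using that by linarith
  qed
  have 5: "sin a \<ge> 0 \<and> sin (b - a) \<ge> 0" if "a \<le> b"
    using that a b by (auto intro!: sin_ge_zero)
  show ?thesis
    unfolding 1 2 a_def[symmetric] b_def[symmetric]
    using 3 4 5 by blast
qed

section \<open>Gradient, reflection in the diagonal and strict convexity\<close>

fun grad1 :: "params \<Rightarrow> real \<times> real \<Rightarrow> real" where
  "grad1 (q0, q1, q2, q3, q4, q5) (x1, x2) = q1 + 2 * q3 * x1 + q4 * x2"

text \<open>The second partial derivative, obtained by reflection, so that facts about the East
  follow from those about the North by passing to \<open>\<sigma> q\<close>.\<close>

definition grad2 :: "params \<Rightarrow> real \<times> real \<Rightarrow> real" where
  "grad2 q x = grad1 (\<sigma> q) (prod.swap x)"

fun quad_form :: "params \<Rightarrow> real \<times> real \<Rightarrow> real" where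
  "quad_form (q0, q1, q2, q3, q4, q5) (x1, x2) = q3 * x1\<^sup>2 + q4 * x1 * x2 + q5 * x2\<^sup>2"

fun pos_def :: "params \<Rightarrow> bool" where
  "pos_def (q0, q1, q2, q3, q4, q5) \<longleftrightarrow> q3 > 0 \<and> q5 > 0 \<and> q4\<^sup>2 < 4 * q3 * q5"

text \<open>The working form of the two assumptions of the theorem; the negative value excludes an
  empty or one-point sublevel set.\<close>

definition nondegenerate :: "params \<Rightarrow> bool" where
  "nondegenerate q \<longleftrightarrow> pos_def q \<and> (\<exists>x. quad q x < 0)"

lemma grad2_simp [simp]:
  "grad2 (q0, q1, q2, q3, q4, q5) (x1, x2) = q2 + q4 * x1 + 2 * q5 * x2"
  by (simp add: grad2_def)

lemma \<sigma>_\<sigma> [simp]: "\<sigma> (\<sigma> q) = q"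
  by (cases q) simp

lemma quad_\<sigma>: "quad (\<sigma> q) x = quad q (prod.swap x)"
  by (cases q; cases x) simp

lemma grad1_\<sigma>: "grad1 (\<sigma> q) x = grad2 q (prod.swap x)"
  by (simp add: grad2_def)

lemma grad2_\<sigma>: "grad2 (\<sigma> q) x = grad1 q (prod.swap x)"
  by (simp add: grad2_def)

lemma pos_def_\<sigma>: "pos_def q \<Longrightarrow> pos_def (\<sigma> q)"
  by (cases q) (simp add: algebra_simps)

lemma nondegenerate_\<sigma>: "nondegenerate q \<Longrightarrow> nondegenerate (\<sigma> q)"
proof -
  assume q: "nondegenerate q"
  then obtain x where "quad q x < 0" by (auto simp: nondegenerate_def)
  hence "quad (\<sigma> q) (prod.swap x) < 0" by (simp add: quad_\<sigma>)
  thus ?thesis using q pos_def_\<sigma> unfolding nondegenerate_def by blast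
qed

lemma quad_taylor:
  "quad q y = quad q x + grad1 q x * (fst y - fst x) + grad2 q x * (snd y - snd x)
     + quad_form q (y - x)"
  by (cases q; cases x; cases y) (simp add: algebra_simps power2_eq_square)

lemma quad_form_pos:
  assumes "pos_def q" "x \<noteq> 0"
  shows "quad_form q x > 0"
proof -
  obtain q0 q1 q2 q3 q4 q5 where q: "q = (q0, q1, q2, q3, q4, q5)" by (cases q)
  obtain x1 x2 where x: "x = (x1, x2)" by (cases x)
  have p: "q3 > 0" "4 * q3 * q5 - q4\<^sup>2 > 0" using assms by (auto simp: q)
  \<comment> \<open>Completing the square after multiplication by \<open>4 * q3\<close>.\<close>
  have "(2 * q3 * x1 + q4 * x2)\<^sup>2 + (4 * q3 * q5 - q4\<^sup>2) * x2\<^sup>2 > 0"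
  proof (cases "x2 = 0")
    case True
    thus ?thesis using p assms by (simp add: x zero_prod_def)
  next
    case False
    thus ?thesis using p by (intro add_nonneg_pos mult_pos_pos) auto
  qed
  also have "\<dots> = 4 * q3 * quad_form q x"
    by (simp add: q x algebra_simps power2_eq_square)
  finally show ?thesis using p(1) by (simp add: zero_less_mult_iff)
qed

text \<open>The solid ellipse lies strictly on one side of each tangent, except at the point of
  contact: the expansion at \<open>x\<close> has a positive second-order term.\<close>

lemma tangent_neg:
  assumes "pos_def q" "quad q x = 0" "quad q y \<le> 0" "x \<noteq> y"
  shows "grad1 q x * (fst y - fst x) + grad2 q x * (snd y - snd x) < 0"
  using quad_taylor[of q y x] quad_form_pos[of q "y - x"] assms by simp

lemma quad_midpoint_neg:
  assumes "pos_def q" "quad q x \<le> 0" "quad q y \<le> 0" "x \<noteq> y"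
  shows "quad q ((1/2) *\<^sub>R (x + y)) < 0"
proof -
  have "quad q ((1/2) *\<^sub>R (x + y)) = (quad q x + quad q y) / 2 - quad_form q (y - x) / 4"
    by (cases q; cases x; cases y) (simp add: field_simps power2_eq_square)
  thus ?thesis using quad_form_pos[of q "y - x"] assms by simp
qed

lemma nondegenerateI:
  assumes "\<And>k. eigenvalue (quad_mat q) k \<Longrightarrow> k > 0"
    and "is_ellipse {x. quad q x \<le> 0}"
  shows "nondegenerate q"
proof -
  obtain q0 q1 q2 q3 q4 q5 where q: "q = (q0, q1, q2, q3, q4, q5)" by (cases q)
  have pd: "pos_def q"
    using pos_def_of_eigenvalues[of q3 "q4 / 2" q5] assms(1)
    by (simp add: q power2_eq_square field_simps)
  obtain A c where A: "linear A" "bij A"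
    and X: "{x. quad q x \<le> 0} = (\<lambda>u. c + A u) ` cball (0 :: real \<times> real) 1"
    using assms(2) unfolding is_ellipse_def by blast
  \<comment> \<open>The images of \<open>0\<close> and \<open>e\<close> are distinct points of the
    solid ellipse, so their midpoint has a negative value.\<close>
  define e :: "real \<times> real" where "e = (1, 0)"
  have e: "e \<in> cball 0 1" "e \<noteq> 0"
    unfolding mem_cball_0 by (simp_all add: e_def norm_Pair zero_prod_def)
  have img: "quad q (c + A u) \<le> 0" if "u \<in> cball 0 1" for u
  proof -
    have "c + A u \<in> {x. quad q x \<le> 0}" unfolding X using that by (rule imageI)
    thus ?thesis by simp
  qed
  have "A e \<noteq> A 0" using A(2) e(2) by (simp add: bij_def inj_eq)
  moreover have "quad q (c + A e) \<le> 0" "quad q (c + A 0) \<le> 0"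
    using img[of e] img[of 0] e(1) by simp_all
  ultimately show ?thesis
    using quad_midpoint_neg[OF pd, of "c + A e" "c + A 0"] pd
    unfolding nondegenerate_def by (metis add_left_cancel)
qed

section \<open>Horizontal sections of the ellipse\<close>

text \<open>The discriminant of \<open>quad q\<close> as a polynomial in the first coordinate at
  height \<open>t\<close>, that is, the radicand in \<open>\<phi>\<close>.\<close>

fun discr :: "params \<Rightarrow> real \<Rightarrow> real" where
  "discr (q0, q1, q2, q3, q4, q5) t = (q1 + q4 * t)\<^sup>2 - 4 * q3 * (q0 + q2 * t + q5 * t\<^sup>2)"

lemma discr_eq: "discr q (snd x) = (grad1 q x)\<^sup>2 - 4 * fst (snd (snd (snd q))) * quad q x"
  by (cases q; cases x) (simp add: algebra_simps power2_eq_square)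

text \<open>The plus sign in \<open>\<phi>\<close> selects the larger root, hence the right-hand
  part of the boundary, where \<open>grad1\<close> is nonnegative.\<close>

lemma grad1_\<phi>: "pos_def q \<Longrightarrow> grad1 q (\<phi> q t, t) = sqrt (discr q t)"
  by (cases q) (simp add: field_simps)

lemma quad_\<phi>:
  assumes "pos_def q" "discr q t \<ge> 0"
  shows "quad q (\<phi> q t, t) = 0"
  using discr_eq[of q "(\<phi> q t, t)"] assms
  by (cases q) (simp add: grad1_\<phi>)

lemma discr_concave:
  assumes "pos_def q" "discr q r \<ge> 0" "discr q t \<ge> 0" "r \<le> s" "s \<le> t"
  shows "discr q s \<ge> 0"
proof -
  obtain q0 q1 q2 q3 q4 q5 where q: "q = (q0, q1, q2, q3, q4, q5)" by (cases q)
  have p: "4 * q3 * q5 - q4\<^sup>2 > 0" using assms(1) by (simp add: q)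
  \<comment> \<open>The last summand is the exact excess over the chord; it is nonnegative because
    the leading coefficient of \<open>discr q\<close> is negative.\<close>
  have eq: "(t - r) * discr q s = (t - s) * discr q r + (s - r) * discr q t
      + (4 * q3 * q5 - q4\<^sup>2) * ((t - s) * (s - r) * (t - r))"
    by (simp add: q algebra_simps power2_eq_square)
  show ?thesis
  proof (cases "r = t")
    case True
    thus ?thesis using assms by (metis order_antisym)
  next
    case False
    have "(t - r) * discr q s \<ge> 0"
      unfolding eq using assms p by (intro add_nonneg_nonneg mult_nonneg_nonneg) auto
    thus ?thesis using False assms by (simp add: zero_le_mult_iff)
  qed
qed

section \<open>The North and the East in closed form\<close>

abbreviation north_pt :: "params \<Rightarrow> real \<times> real" where
  "north_pt q \<equiv> (\<phi> q (\<psi> q), \<psi> q)"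

abbreviation east_pt :: "params \<Rightarrow> real \<times> real" where
  "east_pt q \<equiv> (\<psi> (\<sigma> q), \<phi> (\<sigma> q) (\<psi> (\<sigma> q)))"

text \<open>A horizontal line is tangent at the roots of \<open>discr q\<close>, and
  \<open>\<psi> q\<close> is the larger root.\<close>

lemma north_pt:
  assumes "nondegenerate q"
  shows "quad q (north_pt q) = 0" "grad1 q (north_pt q) = 0" "grad2 q (north_pt q) > 0"
proof -
  obtain q0 q1 q2 q3 q4 q5 where q: "q = (q0, q1, q2, q3, q4, q5)" by (cases q)
  have pd: "pos_def q" using assms by (simp add: nondegenerate_def)
  obtain x where x: "quad q x < 0" using assms by (auto simp: nondegenerate_def)
  define A where "A = 4 * q3 * q5 - q4\<^sup>2"
  define B where "B = 4 * q3 * q2 - 2 * q1 * q4"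
  define C where "C = 4 * q3 * q0 - q1\<^sup>2"
  have A: "A > 0" and q3: "q3 > 0" using pd by (auto simp: A_def q)
  have discr: "discr q t = - (A * t\<^sup>2 + B * t + C)" for t
    by (simp add: q A_def B_def C_def algebra_simps power2_eq_square)
  \<comment> \<open>The line at the height of an interior point cuts the boundary twice; a positive
    value of the concave \<open>discr q\<close> makes its own discriminant positive.\<close>
  have "discr q (snd x) > 0" unfolding discr_eq
  proof -
    have "fst (snd (snd (snd q))) * quad q x < 0"
      using mult_pos_neg[OF q3 x] by (simp add: q)
    thus "0 < (grad1 q x)\<^sup>2 - 4 * fst (snd (snd (snd q))) * quad q x"
      using zero_le_power2[of "grad1 q x"] by linarith
  qed
  hence "4 * A * discr q (snd x) > 0" using A by simp
  moreover have "4 * A * discr q (snd x) = B\<^sup>2 - 4 * A * C - (2 * A * snd x + B)\<^sup>2"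
    by (simp add: discr algebra_simps power2_eq_square)
  ultimately have D: "B\<^sup>2 - 4 * A * C > 0" by (smt (verit) zero_le_power2)
  have "\<psi> q = (- B + sqrt (B\<^sup>2 - 4 * A * C)) / (2 * A)"
    by (simp add: q A_def B_def C_def algebra_simps)
  hence \<psi>: "2 * A * \<psi> q + B = sqrt (B\<^sup>2 - 4 * A * C)" using A by simp
  have "4 * A * discr q (\<psi> q) = B\<^sup>2 - 4 * A * C - (2 * A * \<psi> q + B)\<^sup>2"
    by (simp add: discr algebra_simps power2_eq_square)
  also have "\<dots> = 0" unfolding \<psi> using D by simp
  finally have 0: "discr q (\<psi> q) = 0" using A by simp
  thus "quad q (north_pt q) = 0" using pd by (simp add: quad_\<phi>)
  show g1: "grad1 q (north_pt q) = 0" using 0 pd by (simp only: grad1_\<phi> real_sqrt_zero)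
  \<comment> \<open>The bracket is minus the derivative of \<open>discr q\<close> at its larger
    root, hence positive.\<close>
  have "2 * q3 * grad2 q (north_pt q) = q4 * grad1 q (north_pt q) + (2 * A * \<psi> q + B) / 2"
    by (simp add: q A_def B_def field_simps power2_eq_square del: \<phi>.simps \<psi>.simps)
  also have "\<dots> > 0" unfolding g1 \<psi> using D by simp
  finally show "grad2 q (north_pt q) > 0" using q3 by (simp add: zero_less_mult_iff)
qed

lemma east_pt:
  assumes "nondegenerate q"
  shows "quad q (east_pt q) = 0" "grad1 q (east_pt q) > 0" "grad2 q (east_pt q) = 0"
  using north_pt[OF nondegenerate_\<sigma>[OF assms]]
  by (simp_all add: quad_\<sigma> grad1_\<sigma> grad2_\<sigma>)

lemma THE_strict_max:
  assumes "P a" "\<And>y. P y \<Longrightarrow> y \<noteq> a \<Longrightarrow> g y < (g a :: real)"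
  shows "(THE x. is_arg_max g P x) = a"
proof (rule the_equality)
  show "is_arg_max g P a"
    using assms by (force simp: is_arg_max_def)
  show "x = a" if "is_arg_max g P x" for x
    using that assms by (auto simp: is_arg_max_def)
qed

text \<open>The tangent at \<open>north_pt q\<close> is horizontal, so \<open>tangent_neg\<close>
  puts every other zero strictly lower.\<close>

lemma north_eq:
  assumes "nondegenerate q"
  shows "north q = north_pt q"
  unfolding north_def
proof (rule THE_strict_max)
  fix y assume y: "quad q y = 0" "y \<noteq> north_pt q"
  show "snd y < snd (north_pt q)"
    using tangent_neg[of q "north_pt q" y] y north_pt[OF assms] assms
    by (auto simp: nondegenerate_def mult_less_0_iff)
qed (use north_pt[OF assms] in auto)

lemma east_eq:
  assumes "nondegenerate q"
  shows "east q = east_pt q"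
  unfolding east_def
proof (rule THE_strict_max)
  fix y assume y: "quad q y = 0" "y \<noteq> east_pt q"
  show "fst y < fst (east_pt q)"
    using tangent_neg[of q "east_pt q" y] y east_pt[OF assms] assms
    by (auto simp: nondegenerate_def mult_less_0_iff)
qed (use east_pt[OF assms] in auto)

section \<open>The centre and cross products taken from it\<close>

lemma critical_point_unique:
  assumes "pos_def q" "grad1 q x = 0" "grad2 q x = 0" "grad1 q y = 0" "grad2 q y = 0"
  shows "x = y"
proof (rule ccontr)
  assume "x \<noteq> y"
  hence "quad_form q (x - y) > 0" "quad_form q (y - x) > 0"
    by (simp_all add: quad_form_pos assms(1))
  thus False using quad_taylor[of q x y] quad_taylor[of q y x] assms by simp
qed

lemma centre:
  assumes "pos_def q"
  shows "grad1 q (centre q) = 0" "grad2 q (centre q) = 0"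
proof -
  obtain q0 q1 q2 q3 q4 q5 where q: "q = (q0, q1, q2, q3, q4, q5)" by (cases q)
  define D where "D = 4 * q3 * q5 - q4\<^sup>2"
  have D: "D > 0" using assms by (simp add: q D_def)
  \<comment> \<open>Cramer's rule for the vanishing of the gradient.\<close>
  define c where "c = ((q2 * q4 - 2 * q1 * q5) / D, (q1 * q4 - 2 * q2 * q3) / D)"
  have "D * grad1 q c = 0" "D * grad2 q c = 0"
    using D by (simp_all add: q c_def distrib_left)
      (simp_all add: D_def algebra_simps power2_eq_square)
  hence c: "grad1 q c = 0" "grad2 q c = 0" using D by auto
  \<comment> \<open>The part of \<open>quad q (a + v)\<close> that is odd in \<open>v\<close> is
    linear with the gradient as coefficients, so symmetry about \<open>a\<close> forces a critical
    point.\<close>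
  have diff: "quad q (a + v) - quad q (a - v) = 2 * (grad1 q a * fst v + grad2 q a * snd v)" for a v
    by (cases a; cases v) (simp add: q algebra_simps power2_eq_square)
  have "centre q = c" unfolding centre_def
  proof (rule the_equality)
    show "\<forall>v. quad q (c + v) = quad q (c - v)"
      using diff[of c] c by simp
    fix a assume a: "\<forall>v. quad q (a + v) = quad q (a - v)"
    have "grad1 q a = 0" "grad2 q a = 0"
      using diff[of a "(1, 0)"] diff[of a "(0, 1)"] a by simp_all
    thus "a = c" using critical_point_unique[OF assms] c by blast
  qed
  with c show "grad1 q (centre q) = 0" "grad2 q (centre q) = 0" by simp_all
qed

lemma Im_Complex_divide_sign:
  assumes "(v1, v2) \<noteq> (0, 0)"
  shows "Im (Complex u1 u2 / Complex v1 v2) \<ge> 0 \<longleftrightarrow> u2 * v1 - u1 * v2 \<ge> 0"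
    and "Im (Complex u1 u2 / Complex v1 v2) > 0 \<longleftrightarrow> u2 * v1 - u1 * v2 > 0"
proof -
  have "v1\<^sup>2 + v2\<^sup>2 > 0" using assms by (auto simp: sum_power2_gt_zero_iff)
  thus "Im (Complex u1 u2 / Complex v1 v2) \<ge> 0 \<longleftrightarrow> u2 * v1 - u1 * v2 \<ge> 0"
    "Im (Complex u1 u2 / Complex v1 v2) > 0 \<longleftrightarrow> u2 * v1 - u1 * v2 > 0"
    by (simp_all add: Im_divide zero_le_divide_iff zero_less_divide_iff)
qed

text \<open>Both sides are affine in \<open>x\<close> and vanish on the line through the centre and
  the North, hence are proportional. The factor is positive because the North is above the
  centre.\<close>

lemma cross_north:
  assumes "nondegenerate q"
  obtains k where "k > 0"
    "\<And>x. snd (north q - centre q) * fst (x - centre q) - fst (north q - centre q) * snd (x - centre q)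
           = k * grad1 q x"
proof -
  obtain q0 q1 q2 q3 q4 q5 where q: "q = (q0, q1, q2, q3, q4, q5)" by (cases q)
  have pd: "pos_def q" using assms by (simp add: nondegenerate_def)
  define n where "n = north q"
  obtain c1 c2 where c: "centre q = (c1, c2)" by (cases "centre q")
  obtain n1 n2 where n: "n = (n1, n2)" by (cases n)
  have n': "grad1 q n = 0" "grad2 q n > 0"
    using north_pt[OF assms] unfolding n_def north_eq[OF assms] by auto
  \<comment> \<open>The centre replaces \<open>q1\<close> and \<open>q2\<close>, making the gradient
    linear in \<open>x - centre q\<close>.\<close>
  have "grad1 q (centre q) = 0" "grad2 q (centre q) = 0" using centre[OF pd] by auto
  hence c0: "q1 = - (2 * q3 * c1 + q4 * c2)" "q2 = - (q4 * c1 + 2 * q5 * c2)"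
    unfolding c unfolding q by simp_all
  have n0: "2 * q3 * (n1 - c1) = - (q4 * (n2 - c2))" "q4 * (n1 - c1) + 2 * q5 * (n2 - c2) > 0"
    using n' by (simp_all add: q n c0 algebra_simps)
  have q3: "q3 > 0" "4 * q3 * q5 - q4\<^sup>2 > 0" using pd by (auto simp: q)
  have "0 < 2 * q3 * (q4 * (n1 - c1) + 2 * q5 * (n2 - c2))"
    using q3 n0(2) by simp
  also have "\<dots> = q4 * (2 * q3 * (n1 - c1)) + 4 * q3 * q5 * (n2 - c2)"
    by (simp add: algebra_simps)
  also have "\<dots> = (4 * q3 * q5 - q4\<^sup>2) * (n2 - c2)"
    unfolding n0(1) by (simp add: algebra_simps power2_eq_square)
  finally have n2: "n2 - c2 > 0" using q3(2) by (simp add: zero_less_mult_iff)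
  show thesis
  proof (rule that[of "(n2 - c2) / (2 * q3)"])
    show "(n2 - c2) / (2 * q3) > 0" using n2 q3 by simp
    fix x :: "real \<times> real"
    obtain x1 x2 where x: "x = (x1, x2)" by (cases x)
    have "2 * q3 * ((n2 - c2) * (x1 - c1) - (n1 - c1) * (x2 - c2))
        = (n2 - c2) * (2 * q3 * (x1 - c1)) - (2 * q3 * (n1 - c1)) * (x2 - c2)"
      by (simp add: algebra_simps)
    also have "\<dots> = (n2 - c2) * grad1 q x"
      unfolding n0(1) by (simp add: q x c0 algebra_simps)
    finally show "snd (north q - centre q) * fst (x - centre q)
        - fst (north q - centre q) * snd (x - centre q) = (n2 - c2) / (2 * q3) * grad1 q x"
      unfolding n_def[symmetric] n x c using q3 by (simp add: field_simps)
  qed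
qed

lemma centre_\<sigma>:
  assumes "pos_def q"
  shows "centre (\<sigma> q) = prod.swap (centre q)"
proof (rule critical_point_unique[OF pos_def_\<sigma>[OF assms]])
  show "grad1 (\<sigma> q) (centre (\<sigma> q)) = 0" "grad2 (\<sigma> q) (centre (\<sigma> q)) = 0"
    using centre[OF pos_def_\<sigma>[OF assms]] by auto
  show "grad1 (\<sigma> q) (prod.swap (centre q)) = 0" "grad2 (\<sigma> q) (prod.swap (centre q)) = 0"
    using centre[OF assms] by (simp_all add: grad1_\<sigma> grad2_\<sigma>)
qed

lemma north_\<sigma>: "nondegenerate q \<Longrightarrow> north (\<sigma> q) = prod.swap (east q)"
  by (simp add: north_eq east_eq nondegenerate_\<sigma>)

text \<open>Reflection of \<open>cross_north\<close>; exchanging the coordinates reverses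
  orientation, which accounts for the order of the factors.\<close>

lemma cross_east:
  assumes "nondegenerate q"
  obtains k where "k > 0"
    "\<And>x. snd (x - centre q) * fst (east q - centre q) - fst (x - centre q) * snd (east q - centre q)
           = k * grad2 q x"
proof -
  have pd: "pos_def q" using assms by (simp add: nondegenerate_def)
  obtain k where k: "k > 0"
    "\<And>x. snd (north (\<sigma> q) - centre (\<sigma> q)) * fst (x - centre (\<sigma> q))
        - fst (north (\<sigma> q) - centre (\<sigma> q)) * snd (x - centre (\<sigma> q)) = k * grad1 (\<sigma> q) x"
    using cross_north[OF nondegenerate_\<sigma>[OF assms]] by blast
  show thesis
  proof (rule that[OF k(1)])
    fix x
    show "snd (x - centre q) * fst (east q - centre q) - fst (x - centre q) * snd (east q - centre q)
           = k * grad2 q x"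
      using k(2)[of "prod.swap x"]
      by (simp add: north_\<sigma>[OF assms] centre_\<sigma>[OF pd] grad1_\<sigma> mult.commute)
  qed
qed

section \<open>The arc in terms of gradient signs\<close>

definition pos_grad_arc :: "params \<Rightarrow> (real \<times> real) set" where
  "pos_grad_arc q = {x. quad q x = 0 \<and> grad1 q x \<ge> 0 \<and> grad2 q x \<ge> 0}"

lemma positive_arc_eq:
  assumes "nondegenerate q"
  shows "positive_arc q = pos_grad_arc q"
proof -
  have pd: "pos_def q" using assms by (simp add: nondegenerate_def)
  note g = centre[OF pd]
  have n: "quad q (north q) = 0" "grad2 q (north q) > 0"
    using north_pt[OF assms] unfolding north_eq[OF assms] by auto
  have e: "grad1 q (east q) > 0" "grad2 q (east q) = 0"
    using east_pt[OF assms] unfolding east_eq[OF assms] by auto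
  have nc: "north q \<noteq> centre q" using n g by auto
  have ec: "east q \<noteq> centre q" using e g by auto
  \<comment> \<open>Zeros of \<open>quad q\<close> thus differ from the centre, where the quotient
    in \<open>cw_angle\<close> would be a division by zero.\<close>
  have c: "quad q (centre q) < 0"
    using quad_taylor[of q "north q" "centre q"] quad_form_pos[OF pd, of "north q - centre q"] n g nc
    by simp
  obtain k where k: "k > 0"
    "\<And>x. snd (north q - centre q) * fst (x - centre q) - fst (north q - centre q) * snd (x - centre q)
           = k * grad1 q x" using cross_north[OF assms] by blast
  obtain l where l: "l > 0"
    "\<And>x. snd (x - centre q) * fst (east q - centre q) - fst (x - centre q) * snd (east q - centre q)
           = l * grad2 q x" using cross_east[OF assms] by blast
  let ?C = "\<lambda>x. Complex (fst (x - centre q)) (snd (x - centre q))"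
  have ne: "(fst (x - centre q), snd (x - centre q)) \<noteq> (0, 0)" if "x \<noteq> centre q" for x
    using that by (simp add: prod_eq_iff)
  have nz: "?C x \<noteq> 0" if "x \<noteq> centre q" for x
    using ne[OF that] by (simp add: complex_eq_iff)
  \<comment> \<open>The clockwise turn from North to East is less than a half-turn.\<close>
  have "Im (?C (north q) / ?C (east q)) > 0"
    unfolding Im_Complex_divide_sign(2)[OF ne[OF ec]] k(2) using k(1) e(1) by simp
  hence *: "Arg2pi (?C (north q) / ?C x) \<le> Arg2pi (?C (north q) / ?C (east q))
      \<longleftrightarrow> grad1 q x \<ge> 0 \<and> grad2 q x \<ge> 0" if "x \<noteq> centre q" for x
    unfolding Arg2pi_divide_le_iff[OF nz[OF that] \<open>Im (?C (north q) / ?C (east q)) > 0\<close>]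
      Im_Complex_divide_sign(1)[OF ne[OF that]] Im_Complex_divide_sign(1)[OF ne[OF ec]] k(2) l(2)
    using k(1) l(1) by (simp add: zero_le_mult_iff)
  have "x \<noteq> centre q" if "quad q x = 0" for x using c that by auto
  thus ?thesis
    unfolding positive_arc_def pos_grad_arc_def cw_angle_def using * by blast
qed

lemma arc_\<sigma>: "x \<in> pos_grad_arc (\<sigma> q) \<longleftrightarrow> prod.swap x \<in> pos_grad_arc q"
  by (auto simp: pos_grad_arc_def quad_\<sigma> grad1_\<sigma> grad2_\<sigma>)

lemma north_pt_in_arc: "nondegenerate q \<Longrightarrow> north_pt q \<in> pos_grad_arc q"
  using north_pt[of q] by (simp add: pos_grad_arc_def)

lemma east_pt_in_arc: "nondegenerate q \<Longrightarrow> east_pt q \<in> pos_grad_arc q"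
  using east_pt[of q] by (simp add: pos_grad_arc_def)

section \<open>The arc as a decreasing graph\<close>

lemma arc_antichain:
  assumes "nondegenerate q" "x \<in> pos_grad_arc q" "y \<in> pos_grad_arc q" "fst x \<le> fst y" "snd x \<le> snd y"
  shows "x = y"
proof (rule ccontr)
  assume "x \<noteq> y"
  hence "grad1 q x * (fst y - fst x) + grad2 q x * (snd y - snd x) < 0"
    using tangent_neg[of q x y] assms by (simp add: pos_grad_arc_def nondegenerate_def)
  moreover have "grad1 q x * (fst y - fst x) \<ge> 0" "grad2 q x * (snd y - snd x) \<ge> 0"
    using assms by (auto simp: pos_grad_arc_def)
  ultimately show False by linarith
qed

text \<open>As an equivalence, this transfers bounds between the two coordinates in either
  direction.\<close>

lemma arc_antitone:
  assumes "nondegenerate q" "x \<in> pos_grad_arc q" "y \<in> pos_grad_arc q"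
  shows "fst x \<le> fst y \<longleftrightarrow> snd y \<le> snd x"
  using arc_antichain[OF assms] arc_antichain[OF assms(1,3,2)] by force

lemma \<phi>_in_arc:
  assumes nd: "nondegenerate q" and t: "snd (east_pt q) \<le> t" "t \<le> \<psi> q"
  shows "(\<phi> q t, t) \<in> pos_grad_arc q"
proof -
  have pd: "pos_def q" using nd by (simp add: nondegenerate_def)
  note E = east_pt[OF nd]
  have "discr q (snd (east_pt q)) \<ge> 0" "discr q (snd (north_pt q)) \<ge> 0"
    unfolding discr_eq using E(1) north_pt(1)[OF nd] by simp_all
  hence d: "discr q t \<ge> 0" by (rule discr_concave[OF pd]) (use t in simp_all)
  define p where "p = (\<phi> q t, t)"
  have p: "quad q p = 0" "grad1 q p \<ge> 0"
    using quad_\<phi>[OF pd d] d by (simp_all add: p_def grad1_\<phi>[OF pd])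
  have "grad2 q p \<ge> 0"
  proof (cases "p = east_pt q")
    case False
    \<comment> \<open>The vertical tangent at the East puts \<open>p\<close> to its left; the
      tangent at \<open>p\<close>, tested on the East, then determines the sign of
      \<open>grad2\<close>.\<close>
    have "grad1 q (east_pt q) * (fst p - fst (east_pt q)) < 0"
      using tangent_neg[OF pd E(1), of p] p False E by simp
    hence "fst p < fst (east_pt q)" using E(2) by (simp add: mult_less_0_iff)
    hence "grad1 q p * (fst (east_pt q) - fst p) \<ge> 0" using p by simp
    moreover have "grad1 q p * (fst (east_pt q) - fst p) + grad2 q p * (snd (east_pt q) - snd p) < 0"
      using tangent_neg[OF pd p(1), of "east_pt q"] E False by simp
    ultimately have "grad2 q p * (snd (east_pt q) - snd p) < 0" by linarith
    thus ?thesis using t by (auto simp: p_def mult_less_0_iff)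
  qed (use E in simp)
  with p show ?thesis unfolding pos_grad_arc_def p_def by simp
qed

lemma \<phi>_\<sigma>_in_arc:
  assumes "nondegenerate q" "fst (north_pt q) \<le> t" "t \<le> \<psi> (\<sigma> q)"
  shows "(t, \<phi> (\<sigma> q) t) \<in> pos_grad_arc q"
  using \<phi>_in_arc[OF nondegenerate_\<sigma>[OF assms(1)], of t] assms by (simp add: arc_\<sigma>)

text \<open>The tangents at North and East bound the arc above and on the right; monotonicity turns
  these into the left and lower bounds.\<close>

lemma arc_subset_arc_box:
  assumes "nondegenerate q" "x \<in> pos_grad_arc q"
  shows "x \<in> arc_box q"
proof -
  have pd: "pos_def q" using assms by (simp add: nondegenerate_def)
  have x: "quad q x = 0" using assms by (simp add: pos_grad_arc_def)
  have N: "snd x \<le> snd (north_pt q)"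
    using tangent_neg[OF pd north_pt(1)[OF assms(1)], of x] north_pt[OF assms(1)] x
    by (cases "x = north_pt q") (auto simp: mult_less_0_iff)
  have E: "fst x \<le> fst (east_pt q)"
    using tangent_neg[OF pd east_pt(1)[OF assms(1)], of x] east_pt[OF assms(1)] x
    by (cases "x = east_pt q") (auto simp: mult_less_0_iff)
  have "fst (north_pt q) \<le> fst x"
    using N arc_antitone[OF assms(1) north_pt_in_arc[OF assms(1)] assms(2)] by simp
  moreover have "snd (east_pt q) \<le> snd x"
    using E arc_antitone[OF assms(1,2) east_pt_in_arc[OF assms(1)]] by simp
  ultimately show ?thesis using N E by (cases x) (simp add: arc_box_def)
qed

section \<open>Minimality of the contracted box\<close>

lemma box_sides:
  fixes a b c d :: real
  assumes "{a..b} \<times> {c..d} \<noteq> {}"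
  shows "Inf (fst ` ({a..b} \<times> {c..d})) = a" "Sup (fst ` ({a..b} \<times> {c..d})) = b"
    "Inf (snd ` ({a..b} \<times> {c..d})) = c" "Sup (snd ` ({a..b} \<times> {c..d})) = d"
  using assms by auto

lemma smallest_box_arc:
  assumes nd: "nondegenerate q" and X: "is_box X"
  shows "is_smallest_box (X \<inter> pos_grad_arc q) (C0 q X)"
proof -
  obtain a b c d where X: "X = {a..b} \<times> {c..d}" using X by (auto simp: is_box_def)
  obtain n1 n2 where N: "north_pt q = (n1, n2)" by simp
  obtain e1 e2 where E: "east_pt q = (e1, e2)" by simp
  define l1 where "l1 = max a n1"
  define h1 where "h1 = min b e1"
  define l2 where "l2 = max c e2"
  define h2 where "h2 = min d n2"
  have box: "arc_box q = {n1..e1} \<times> {e2..n2}"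
    using N E by (auto simp: arc_box_def)
  have b: "X \<inter> arc_box q = {l1..h1} \<times> {l2..h2}"
    unfolding X box l1_def h1_def l2_def h2_def by auto
  have sub: "X \<inter> pos_grad_arc q \<subseteq> {l1..h1} \<times> {l2..h2}"
    using arc_subset_arc_box[OF nd] unfolding b[symmetric] by auto
  have box_empty: "is_box {}" unfolding is_box_def
    by (rule exI[of _ 1], rule exI[of _ 0]) simp
  show ?thesis
  proof (cases "X \<inter> arc_box q = {}")
    case True
    hence "C0 q X = {}" "X \<inter> pos_grad_arc q = {}"
      using arc_subset_arc_box[OF nd] by (auto simp: C0_def)
    thus ?thesis using box_empty by (simp add: is_smallest_box_def)
  next
    case False
    hence ne: "{l1..h1} \<times> {l2..h2} \<noteq> {}" unfolding b .
    hence le: "l1 \<le> h1" "l2 \<le> h2" by auto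
    have C0: "C0 q X = X \<inter> ({\<phi> q h2..\<phi> q l2} \<times> {\<phi> (\<sigma> q) h1..\<phi> (\<sigma> q) l1})"
      using ne unfolding C0_def Let_def b box_sides[OF ne] by simp
    have Q: "(\<phi> q t, t) \<in> pos_grad_arc q" if "e2 \<le> t" "t \<le> n2" for t
      using \<phi>_in_arc[OF nd, of t] N E that by simp
    have R: "(t, \<phi> (\<sigma> q) t) \<in> pos_grad_arc q" if "n1 \<le> t" "t \<le> e1" for t
      using \<phi>_\<sigma>_in_arc[OF nd, of t] N E that by simp
    have l: "n1 \<le> l1" "h1 \<le> e1" "e2 \<le> l2" "h2 \<le> n2" "a \<le> l1" "h1 \<le> b" "c \<le> l2" "h2 \<le> d"
      by (auto simp: l1_def h1_def l2_def h2_def)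
    \<comment> \<open>The arc points at the endpoints of the sides of
      \<open>X \<inter> arc_box q\<close>; comparison with them gives all bounds below.\<close>
    have P: "(\<phi> q h2, h2) \<in> pos_grad_arc q" "(\<phi> q l2, l2) \<in> pos_grad_arc q"
      "(h1, \<phi> (\<sigma> q) h1) \<in> pos_grad_arc q" "(l1, \<phi> (\<sigma> q) l1) \<in> pos_grad_arc q"
      using l le by (auto intro!: Q R)
    note anti = arc_antitone[OF nd]
    have "is_box (C0 q X)"
      unfolding C0 unfolding X Times_Int_Times Int_atLeastAtMost is_box_def by blast
    moreover have "X \<inter> pos_grad_arc q \<subseteq> C0 q X"
    proof
      fix x assume x: "x \<in> X \<inter> pos_grad_arc q"
      with sub have "l1 \<le> fst x" "fst x \<le> h1" "l2 \<le> snd x" "snd x \<le> h2" by auto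
      thus "x \<in> C0 q X"
        using x anti[OF P(1), of x] anti[OF _ P(2), of x] anti[OF _ P(3), of x] anti[OF P(4), of x]
        unfolding C0 by (cases x) auto
    qed
    moreover have "C0 q X \<subseteq> B" if "is_box B" and sub: "X \<inter> pos_grad_arc q \<subseteq> B" for B
    proof
      \<comment> \<open>For each coordinate of \<open>z\<close>, some point of the arc inside
        \<open>X\<close> shares it. A box containing these two points contains
        \<open>z\<close>.\<close>
      fix z assume z: "z \<in> C0 q X"
      obtain z1 z2 where z12: "z = (z1, z2)" by (cases z)
      obtain u v w t where B: "B = {u..v} \<times> {w..t}" using \<open>is_box B\<close> by (auto simp: is_box_def)
      have z': "a \<le> z1" "z1 \<le> b" "c \<le> z2" "z2 \<le> d" "\<phi> q h2 \<le> z1" "z1 \<le> \<phi> q l2"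
        "\<phi> (\<sigma> q) h1 \<le> z2" "z2 \<le> \<phi> (\<sigma> q) l1"
        using z unfolding C0 by (auto simp: X z12)
      have in_box: "n1 \<le> fst x \<and> fst x \<le> e1 \<and> e2 \<le> snd x \<and> snd x \<le> n2" if "x \<in> pos_grad_arc q" for x
        using arc_subset_arc_box[OF nd that] unfolding box by auto
      have r: "(z1, \<phi> (\<sigma> q) z1) \<in> pos_grad_arc q"
        using R[of z1] z' in_box[OF P(1)] in_box[OF P(2)] by auto
      \<comment> \<open>Its abscissa is between those of the arc points at heights \<open>h2\<close>
        and \<open>l2\<close>, so its height is between \<open>l2\<close> and
        \<open>h2\<close>.\<close>
      have "(z1, \<phi> (\<sigma> q) z1) \<in> X"
        using anti[OF P(1) r] anti[OF r P(2)] z' l unfolding X by auto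
      with r sub have 1: "(z1, \<phi> (\<sigma> q) z1) \<in> B" by auto
      have r: "(\<phi> q z2, z2) \<in> pos_grad_arc q"
        using Q[of z2] z' in_box[OF P(3)] in_box[OF P(4)] by auto
      have "(\<phi> q z2, z2) \<in> X"
        using anti[OF r P(3)] anti[OF P(4) r] z' l unfolding X by auto
      with r sub have "(\<phi> q z2, z2) \<in> B" by auto
      with 1 show "z \<in> B" by (simp add: B z12)
    qed
    ultimately show ?thesis unfolding is_smallest_box_def by blast
  qed
qed

theorem proposition4:
  fixes q :: params
  assumes "\<And>k. eigenvalue (quad_mat q) k \<Longrightarrow> k > 0"
    and "is_ellipse {x. quad q x \<le> 0}"
  shows "is_minimal_contractor (positive_arc q) (C0 q)"
  using smallest_box_arc positive_arc_eq nondegenerateI[OF assms]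
  by (simp add: is_minimal_contractor_def)

end
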